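(* Suppose that $f\in\mathcal{B}$ and $f(z)=\sum_{n=0}^{\infty}a_nz^n$. Then $$\sum_{n=0}^{\infty}|a_n|r^n+\left(\frac{1}{1+|a_0|}+\frac{r}{1-r}\right)\sum_{n=1}^{\infty}|a_n|^2r^{2n}+|f(z)-a_0|^2\le 1\quad\text{for } |z|=r\le\frac13$$ if and only if $0\le|a_0|\le 4\sqrt2-5\approx 0.656854$.
   Context: $\mathbb{D}=\{z\in\mathbb{C}:|z|<1\}$ is the unit disk and $\mathcal{B}$ is the set of all analytic self-maps of $\mathbb{D}$.
   Formalization: Read for one fixed f the "only if" fails (the constant f = 0.9 satisfies the inequality); the formal theorem states that, for given a_0 in the disk, the inequality holds for all f in B with that constant coefficient if and only if |a_0| ≤ 4√2−5. *)

theory Defs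
  imports "HOL-Complex_Analysis.Complex_Analysis"
begin

abbreviation unit_disk :: "complex set" (\<open>\<bbbD>\<close>) where
  "\<bbbD> \<equiv> ball 0 1"

definition analytic_self_maps :: "(complex \<Rightarrow> complex) set" (\<open>\<B>\<close>) where
  "\<B> = {f. f analytic_on \<bbbD> \<and> f ` \<bbbD> \<subseteq> \<bbbD>}"

(* The values of f outside the disk are irrelevant; the coefficient sequence is
   determined by f. *)
definition has_power_series_on_disk :: "(complex \<Rightarrow> complex) \<Rightarrow> (nat \<Rightarrow> complex) \<Rightarrow> bool" where
  "has_power_series_on_disk f a \<longleftrightarrow> (\<forall>z\<in>\<bbbD>. (\<lambda>n. a n * z ^ n) sums f z)"

end

theory Submission imports Defs begin

text \<open>
  Write $\alpha = |a_0|$. For a polynomial $p$, Cauchy's formula and Parseval's identity bound the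
  $N$-th coefficient of $f p^2$ by the sum of the squared moduli of the coefficients of $p$.
  Choosing the higher coefficients of $p$ proportional to $\overline{a_k}$ gives Carlson's inequalities
  $|a_{2n+1}| \le 1 - \sum_{k \le n} |a_k|^2$ and
  $|a_{2n}| \le 1 - \sum_{k < n} |a_k|^2 - |a_n|^2 / (1 + \alpha)$. Multiplied by powers of $r$ and
  summed, they bound the first two terms of the Bohr sum by $\alpha + (1 - \alpha^2) r / (1 - r)$,
  while the Schwarz--Pick lemma gives $|f(z) - a_0| \le r (1 - \alpha^2) / (1 - \alpha r)$.
  Both bounds increase with $r$, and at $r = 1/3$ the resulting bound
  $\alpha + (1 - \alpha^2) / 2 + ((1 - \alpha^2) / (3 - \alpha))^2$ is at most $1$ exactly when
  $\sqrt 2 (1 + \alpha) \le 3 - \alpha$. For $a_0 \neq 0$, the map $(a_0 - z) / (1 - \overline{a_0} z)$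
  attains all of these bounds at $z = a_0 / (3 \alpha)$.
\<close>

section \<open>Orthogonality of exponentials and Parseval's identity on circles\<close>

lemma has_integral_cis_int:
  "((\<lambda>t. cis (2 * pi * of_int k * t)) has_integral (if k = 0 then 1 else 0)) {0..1}"
proof (cases "k = 0")
  case True
  then show ?thesis using has_integral_const_real[of "1::complex" 0 1] by simp
next
  case False
  define c :: complex where "c = 2 * pi * of_int k * \<i>"
  have c: "c \<noteq> 0" using False by (simp add: c_def)
  have cis: "cis (2 * pi * of_int k * t) = exp (c * of_real t)" for t
    by (simp add: cis_conv_exp c_def mult_ac)
  \<comment> \<open>The antiderivative \<open>exp (c * t) / c\<close> takes equal values at both
    ends because \<open>exp c = 1\<close>.\<close>
  have "((\<lambda>t. exp (c * of_real t)) has_integral exp (c * of_real 1) / c - exp (c * of_real 0) / c) {0..1}"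
    by (rule fundamental_theorem_of_calculus)
       (auto intro!: derivative_eq_intros has_vector_derivative_real_field simp: c)
  moreover have "exp c = 1"
    using exp_integer_2pi[of "of_int k"] by (simp add: c_def mult_ac)
  ultimately show ?thesis using False by (simp add: cis)
qed

text \<open>Expanding the squared modulus gives a double sum over pairs of coefficients; integration
  over a full period kills every pair with \<open>i\<close> different from \<open>j\<close> and
  leaves the diagonal.\<close>

lemma Parseval_poly_circle:
  fixes p :: "complex poly"
  shows "((\<lambda>t. (norm (poly p (of_real \<rho> * cis (2 * pi * t))))\<^sup>2) has_integral
           (\<Sum>i\<le>degree p. (norm (coeff p i))\<^sup>2 * \<rho> ^ (2 * i))) {0..1}"
proof -
  define c where "c = coeff p"
  define d where "d = degree p"
  let ?z = "\<lambda>t. of_real \<rho> * cis (2 * pi * t)"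
  have expand: "of_real ((norm (poly p (?z t)))\<^sup>2) =
      (\<Sum>i\<le>d. \<Sum>j\<le>d. (c i * cnj (c j) * of_real \<rho> ^ (i + j)) * cis (2 * pi * of_int (int i - int j) * t))" for t
  proof -
    have "of_real ((norm (poly p (?z t)))\<^sup>2) = poly p (?z t) * cnj (poly p (?z t))"
      by (rule complex_norm_square)
    also have "\<dots> = (\<Sum>i\<le>d. \<Sum>j\<le>d. (c i * ?z t ^ i) * cnj (c j * ?z t ^ j))"
      by (simp add: poly_altdef sum_product c_def d_def)
    also have "\<dots> = (\<Sum>i\<le>d. \<Sum>j\<le>d. (c i * cnj (c j) * of_real \<rho> ^ (i + j)) *
                      cis (2 * pi * of_int (int i - int j) * t))"
    proof (intro sum.cong refl)
      fix i j
      have "?z t ^ i * cnj (?z t) ^ j = of_real \<rho> ^ (i + j) * (cis (real i * (2*pi*t)) * cis (- (real j * (2*pi*t))))"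
        by (simp add: power_mult_distrib power_add Complex.DeMoivre cis_cnj mult_ac)
      also have "cis (real i * (2*pi*t)) * cis (- (real j * (2*pi*t))) = cis (2 * pi * of_int (int i - int j) * t)"
        unfolding cis_mult by (simp add: algebra_simps)
      finally show "(c i * ?z t ^ i) * cnj (c j * ?z t ^ j) =
          (c i * cnj (c j) * of_real \<rho> ^ (i + j)) * cis (2 * pi * of_int (int i - int j) * t)"
        by (simp add: mult_ac)
    qed
    finally show ?thesis .
  qed
  have "((\<lambda>t. \<Sum>i\<le>d. \<Sum>j\<le>d. (c i * cnj (c j) * of_real \<rho> ^ (i + j)) * cis (2 * pi * of_int (int i - int j) * t))
     has_integral (\<Sum>i\<le>d. \<Sum>j\<le>d. (c i * cnj (c j) * of_real \<rho> ^ (i + j)) * (if int i - int j = 0 then 1 else 0))) {0..1}"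
    by (intro has_integral_sum has_integral_mult_right has_integral_cis_int) auto
  also have "(\<Sum>i\<le>d. \<Sum>j\<le>d. (c i * cnj (c j) * of_real \<rho> ^ (i + j)) * (if int i - int j = 0 then 1 else 0))
     = (\<Sum>i\<le>d. \<Sum>j\<le>d. if j = i then c i * cnj (c i) * of_real \<rho> ^ (i + i) else 0)"
    by (intro sum.cong) auto
  also have "\<dots> = of_real (\<Sum>i\<le>d. (norm (c i))\<^sup>2 * \<rho> ^ (2 * i))"
    by (simp add: complex_norm_square[symmetric] mult_2)
  finally have "((\<lambda>t. complex_of_real ((norm (poly p (?z t)))\<^sup>2)) has_integral
      of_real (\<Sum>i\<le>d. (norm (c i))\<^sup>2 * \<rho> ^ (2 * i))) {0..1}"
    by (simp only: expand)
  from has_integral_Re[OF this] show ?thesis by (simp add: c_def d_def)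
qed

section \<open>Coefficients of \<open>f\<close> times the square of a polynomial\<close>

lemma has_fps_expansion_power_series:
  assumes "has_power_series_on_disk f a"
  shows "f has_fps_expansion Abs_fps a"
proof -
  have "conv_radius a \<ge> 1"
  proof (rule conv_radius_geI_ex)
    fix r :: real assume "0 < r" "ereal r < 1"
    then show "\<exists>z. norm z = r \<and> summable (\<lambda>n. a n * z ^ n)"
      using assms by (intro exI[of _ "of_real r"]) (auto simp: has_power_series_on_disk_def sums_iff)
  qed
  then have "fps_conv_radius (Abs_fps a) > 0"
    by (auto simp: fps_conv_radius_def zero_ereal_def intro: less_le_trans[of _ 1])
  moreover have "\<forall>\<^sub>F z in nhds 0. eval_fps (Abs_fps a) z = f z"
    using assms
    by (intro eventually_nhds_in_open[of "ball 0 1", THEN eventually_mono])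
       (auto simp: eval_fps_def has_power_series_on_disk_def sums_iff)
  ultimately show ?thesis by (simp add: has_fps_expansion_def)
qed

lemma power_series_coeff_0:
  assumes "has_power_series_on_disk f a"
  shows "f 0 = a 0"
proof -
  have "(\<lambda>n. a n * 0 ^ n) sums f 0"
    using assms by (auto simp only: has_power_series_on_disk_def mem_ball_0 norm_zero zero_less_one)
  then show ?thesis by simp
qed

lemma analytic_self_mapsD:
  assumes "f \<in> \<B>"
  shows "f holomorphic_on \<bbbD>" "\<And>z. norm z < 1 \<Longrightarrow> norm (f z) < 1"
  using assms by (auto simp: analytic_self_maps_def analytic_imp_holomorphic image_subset_iff)

text \<open>The polynomial enters squared so that its modulus on a circle is |p|^2, whose mean
  Parseval evaluates exactly. Cauchy's formula writes the coefficient as a mean of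
  \<open>f p^2 / z^N\<close>, and |f| is at most 1. Letting the radius tend to 1 removes the powers
  of \<rho>.\<close>

lemma coeff_mult_square_le:
  fixes p :: "complex poly"
  assumes f: "f \<in> \<B>" and ps: "has_power_series_on_disk f a"
  shows "norm (fps_nth (Abs_fps a * fps_of_poly (p ^ 2)) N) \<le> (\<Sum>i\<le>degree p. (norm (coeff p i))\<^sup>2)"
proof -
  define c where "c = fps_nth (Abs_fps a * fps_of_poly (p ^ 2)) N"
  define h where "h = (\<lambda>z. f z * (poly p z)\<^sup>2)"
  note holf = analytic_self_mapsD(1)[OF f] and f1 = analytic_self_mapsD(2)[OF f]
  have holh: "h holomorphic_on ball 0 1"
    unfolding h_def by (intro holomorphic_intros holf)
  have "(\<lambda>z. poly (p ^ 2) z) has_fps_expansion fps_of_poly (p ^ 2)"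
    by (simp add: has_fps_expansion_def)
  then have "h has_fps_expansion (Abs_fps a * fps_of_poly (p ^ 2))"
    unfolding h_def
    using has_fps_expansion_mult[OF has_fps_expansion_power_series[OF ps]] by (simp flip: poly_power)
  then have c: "c = (deriv ^^ N) h 0 / fact N"
    unfolding c_def by (rule fps_nth_fps_expansion)
  have two_pi_i: "2 * pi * \<i> \<noteq> 0" by simp
  have cancel: "inverse K * (K * y) = y" if "K \<noteq> 0" for K y :: complex
    using that by simp
  have bound: "norm c * \<rho> ^ N \<le> (\<Sum>i\<le>degree p. (norm (coeff p i))\<^sup>2 * \<rho> ^ (2 * i))"
    if \<rho>: "0 < \<rho>" "\<rho> < 1" for \<rho>
  proof -
    let ?z = "\<lambda>t. of_real \<rho> * cis (2 * pi * t)"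
    have "((\<lambda>u. h u / (u - 0) ^ Suc N) has_contour_integral ((2 * pi * \<i>) / (fact N) * (deriv ^^ N) h 0))
            (circlepath 0 \<rho>)"
      by (rule Cauchy_has_contour_integral_higher_derivative_circlepath)
         (use \<rho> in \<open>auto intro!: holomorphic_on_imp_continuous_on holomorphic_on_subset[OF holh]\<close>)
    then have "((\<lambda>u. h u / u ^ Suc N) has_contour_integral (2 * pi * \<i> * c)) (circlepath 0 \<rho>)"
      by (simp add: c)
    then have int0: "((\<lambda>t. h (circlepath 0 \<rho> t) / circlepath 0 \<rho> t ^ Suc N *
            vector_derivative (circlepath 0 \<rho>) (at t within {0..1})) has_integral (2 * pi * \<i> * c)) {0..1}"
      by (simp only: has_contour_integral_def)
    \<comment> \<open>On the circle dz = 2 pi i z dt, so one factor \<open>z\<close> cancels and the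
      exponent drops from \<open>Suc N\<close> to \<open>N\<close>.\<close>
    have eq: "h (circlepath 0 \<rho> t) / circlepath 0 \<rho> t ^ Suc N *
            vector_derivative (circlepath 0 \<rho>) (at t within {0..1}) = (2 * pi * \<i>) * (h (?z t) / ?z t ^ N)"
      if "t \<in> {0..1}" for t
    proof -
      have "vector_derivative (circlepath 0 \<rho>) (at t within {0..1}) = 2 * pi * \<i> * ?z t"
        using that by (simp add: vector_derivative_circlepath01 cis_conv_exp mult_ac)
      moreover have "circlepath 0 \<rho> t = ?z t"
        by (simp add: circlepath cis_conv_exp mult_ac)
      ultimately show ?thesis using \<rho> by simp
    qed
    have "((\<lambda>t. (2 * pi * \<i>) * (h (?z t) / ?z t ^ N)) has_integral (2 * pi * \<i> * c)) {0..1}"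
      by (rule has_integral_eq[OF eq int0])
    from has_integral_mult_right[OF this, of "inverse (2 * pi * \<i>)"]
    have "((\<lambda>t. h (?z t) / ?z t ^ N) has_integral c) {0..1}"
      by (simp only: cancel[OF two_pi_i])
    \<comment> \<open>Multiplying by \<open>\<rho> ^ N\<close> cancels the modulus of
      \<open>z^N\<close>, so that the integrand is bounded by |p|^2 alone.\<close>
    then have int: "((\<lambda>t. h (?z t) / ?z t ^ N * of_real \<rho> ^ N) has_integral c * of_real \<rho> ^ N) {0..1}"
      by (rule has_integral_mult_left)
    have "norm (integral {0..1} (\<lambda>t. h (?z t) / ?z t ^ N * of_real \<rho> ^ N)) \<le>
          integral {0..1} (\<lambda>t. (norm (poly p (?z t)))\<^sup>2)"
    proof (rule integral_norm_bound_integral)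
      fix t
      have "norm (f (?z t)) \<le> 1"
        using f1[of "?z t"] \<rho> by (simp add: norm_mult)
      then show "norm (h (?z t) / ?z t ^ N * of_real \<rho> ^ N) \<le> (norm (poly p (?z t)))\<^sup>2"
        using \<rho> by (simp add: h_def norm_mult norm_divide norm_power mult_left_le_one_le)
    qed (use int Parseval_poly_circle[of p \<rho>] in \<open>auto intro: has_integral_integrable\<close>)
    then show ?thesis
      unfolding integral_unique[OF int] integral_unique[OF Parseval_poly_circle] norm_mult norm_power norm_of_real
      using \<rho> by simp
  qed
  \<comment> \<open>Since \<open>f\<close> is holomorphic on the open disk only, the value \<rho> =
    1 is reached as a limit from the left.\<close>
  have "((\<lambda>\<rho>. norm c * \<rho> ^ N) \<longlongrightarrow> norm c * 1 ^ N) (at_left 1)"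
    by (intro tendsto_intros)
  moreover have "\<forall>\<^sub>F \<rho> in at_left 1. norm c * \<rho> ^ N \<le> (\<Sum>i\<le>degree p. (norm (coeff p i))\<^sup>2)"
    using eventually_at_left_real[of 0 1, simplified]
  proof eventually_elim
    case (elim \<rho>)
    have "norm c * \<rho> ^ N \<le> (\<Sum>i\<le>degree p. (norm (coeff p i))\<^sup>2 * \<rho> ^ (2 * i))"
      using elim by (intro bound) auto
    also have "\<dots> \<le> (\<Sum>i\<le>degree p. (norm (coeff p i))\<^sup>2)"
      using elim by (intro sum_mono mult_right_le_one_le) (auto intro: power_le_one)
    finally show ?case .
  qed
  ultimately show ?thesis
    unfolding c_def[symmetric] using tendsto_upperbound by fastforce
qed

text \<open>The case $p = 1 + X^m Q$ of the previous lemma, where $q$ lists the coefficients of $Q$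
  in reverse order.\<close>
lemma coeff_test_poly_le:
  fixes q :: "nat \<Rightarrow> complex"
  assumes f: "f \<in> \<B>" and ps: "has_power_series_on_disk f a" and m: "m > 0" and N: "N = m + n" "n \<le> m"
  shows "norm (a N + 2 * (\<Sum>i\<le>n. a i * q i) + (if n = m then a 0 * (q n)\<^sup>2 else 0))
           \<le> 1 + (\<Sum>i\<le>n. (norm (q i))\<^sup>2)"
proof -
  define Q where "Q = (\<Sum>i\<le>n. monom (q (n - i)) i)"
  have coeff_Q: "coeff Q i = (if i \<le> n then q (n - i) else 0)" for i
    by (simp add: Q_def coeff_sum)
  define p where "p = 1 + monom 1 m * Q"
  have coeff_p: "coeff p i = (if i = 0 then 1 else if m \<le> i \<and> i \<le> N then q (N - i) else 0)" for i
    using m N by (auto simp: p_def coeff_monom_mult coeff_Q add.commute)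
  have "degree p \<le> N"
    by (rule degree_le) (use m N in \<open>auto simp: coeff_p\<close>)
  then have "(\<Sum>i\<le>degree p. (norm (coeff p i))\<^sup>2) = (\<Sum>i\<le>N. (norm (coeff p i))\<^sup>2)"
    by (intro sum.mono_neutral_left) (auto simp: coeff_eq_0)
  also have "\<dots> = (\<Sum>i\<in>insert 0 {m..N}. (norm (coeff p i))\<^sup>2)"
    by (rule sum.mono_neutral_right) (auto simp: coeff_p)
  also have "\<dots> = 1 + (\<Sum>i\<in>{m..N}. (norm (q (N - i)))\<^sup>2)"
    using m by (simp add: coeff_p)
  also have "(\<Sum>i\<in>{m..N}. (norm (q (N - i)))\<^sup>2) = (\<Sum>i\<le>n. (norm (q i))\<^sup>2)"
    by (rule sum.reindex_bij_witness[of _ "\<lambda>i. N - i" "\<lambda>i. N - i"]) (use N in auto)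
  finally have norm_p: "(\<Sum>i\<le>degree p. (norm (coeff p i))\<^sup>2) = 1 + (\<Sum>i\<le>n. (norm (q i))\<^sup>2)" .
  have expand: "F * (1 + Y * G)\<^sup>2 = F + Y * (F * G) + Y * (F * G) + Y\<^sup>2 * (F * G\<^sup>2)" for F Y G :: "complex fps"
    by (simp add: power2_eq_square algebra_simps)
  let ?F = "Abs_fps a" and ?G = "fps_of_poly Q"
  have "fps_of_poly p = 1 + fps_X ^ m * ?G"
    by (simp add: p_def fps_of_poly_add fps_of_poly_mult fps_of_poly_monom')
  then have fps_p: "?F * fps_of_poly (p ^ 2) =
      ?F + fps_X ^ m * (?F * ?G) + fps_X ^ m * (?F * ?G) + fps_X ^ (2 * m) * (?F * ?G ^ 2)"
    using expand[of ?F "fps_X ^ m" ?G] by (simp only: fps_of_poly_power power_mult mult.commute[of 2 m])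
  \<comment> \<open>The reversed order of the coefficients in \<open>Q\<close> makes the Cauchy
    product at index \<open>n\<close> pair \<open>a i\<close> with \<open>q i\<close>.\<close>
  have FG: "fps_nth (?F * ?G) n = (\<Sum>i\<le>n. a i * q i)"
    unfolding fps_mult_nth by (intro sum.cong) (auto simp: coeff_Q atMost_atLeast0)
  \<comment> \<open>The quadratic term starts at degree \<open>2 * m\<close>, and
    \<open>N = m + n\<close> with \<open>n \<le> m\<close>, so it reaches degree \<open>N\<close>
    only if \<open>n = m\<close>. It then contributes its constant coefficient, where
    \<open>coeff Q 0 = q n\<close>.\<close>
  have "fps_nth (?F * fps_of_poly (p ^ 2)) N = a N + 2 * (\<Sum>i\<le>n. a i * q i) + (if n = m then a 0 * (q n)\<^sup>2 else 0)"
    unfolding fps_p fps_add_nth fps_X_power_mult_nth using N m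
    by (auto simp: FG coeff_Q power2_eq_square)
  then show ?thesis
    using coeff_mult_square_le[OF f ps, of p N] norm_p by simp
qed

section \<open>Carlson's inequalities\<close>

lemma phase_exists: "\<exists>\<mu>::complex. norm \<mu> = 1 \<and> z = \<mu> * of_real (norm z)"
  by (intro exI[of _ "if z = 0 then 1 else sgn z"]) (auto simp: sgn_eq norm_divide)

text \<open>With \<mu> the phase of the top coefficient, the choice
  \<open>q i = \<mu> * cnj (a i)\<close> gives all terms on the left the same phase. The left side
  becomes \<open>norm (a (2 * n + 1)) + 2 * S\<close> and the right side \<open>1 + S\<close>.
  Taking \<open>m = Suc n\<close> keeps the quadratic term away.\<close>

lemma Carlson_odd:
  assumes f: "f \<in> \<B>" and ps: "has_power_series_on_disk f a"
  shows "norm (a (2 * n + 1)) + (\<Sum>i\<le>n. (norm (a i))\<^sup>2) \<le> 1"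
proof -
  obtain \<mu> :: complex where \<mu>: "norm \<mu> = 1" "a (2 * n + 1) = \<mu> * of_real (norm (a (2 * n + 1)))"
    using phase_exists by blast
  define S where "S = (\<Sum>i\<le>n. (norm (a i))\<^sup>2)"
  have S0: "S \<ge> 0" unfolding S_def by (intro sum_nonneg) auto
  have S: "(\<Sum>i\<le>n. a i * (\<mu> * cnj (a i))) = \<mu> * of_real S"
    unfolding S_def of_real_sum sum_distrib_left
    by (intro sum.cong refl) (metis complex_norm_square mult.left_commute)
  have "norm (a (2 * n + 1) + 2 * (\<Sum>i\<le>n. a i * (\<mu> * cnj (a i)))) \<le> 1 + (\<Sum>i\<le>n. (norm (\<mu> * cnj (a i)))\<^sup>2)"
    using coeff_test_poly_le[OF f ps, of "Suc n" "2 * n + 1" n "\<lambda>i. \<mu> * cnj (a i)"] by simp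
  also have "(\<Sum>i\<le>n. (norm (\<mu> * cnj (a i)))\<^sup>2) = S"
    using \<mu> by (simp add: norm_mult S_def)
  also have "a (2 * n + 1) + 2 * (\<Sum>i\<le>n. a i * (\<mu> * cnj (a i))) = \<mu> * of_real (norm (a (2 * n + 1)) + 2 * S)"
    unfolding S by (subst \<mu>(2)) (simp add: algebra_simps)
  also have "norm \<dots> = norm (a (2 * n + 1)) + 2 * S"
    using S0 unfolding norm_mult \<mu>(1) norm_of_real by simp
  finally show ?thesis by (simp add: S_def)
qed

text \<open>Here \<open>m = n\<close>, so the quadratic term \<open>a 0 * (q n)^2\<close> appears
  and may have the wrong phase. The last test coefficient therefore gets a damping weight \<tau>,
  and the quadratic term is estimated by the triangle inequality.\<close>

lemma Carlson_even:
  assumes f: "f \<in> \<B>" and ps: "has_power_series_on_disk f a" and n: "n > 0"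
  shows "norm (a (2 * n)) + (\<Sum>i<n. (norm (a i))\<^sup>2) + (norm (a n))\<^sup>2 / (1 + norm (a 0)) \<le> 1"
proof -
  obtain \<mu> :: complex where \<mu>: "norm \<mu> = 1" "a (2 * n) = \<mu> * of_real (norm (a (2 * n)))"
    using phase_exists by blast
  define S where "S = (\<Sum>i<n. (norm (a i))\<^sup>2)"
  \<comment> \<open>A weight \<tau> on the last coefficient yields the net gain
    \<open>(2 * \<tau> - \<tau>^2 * (1 + norm (a 0))) * b\<close>; this value of \<tau> maximizes
    it, and the gain is then \<open>\<tau> * b\<close>.\<close>
  define \<tau> where "\<tau> = 1 / (1 + norm (a 0))"
  define b where "b = (norm (a n))\<^sup>2"
  define q where "q = (\<lambda>i. if i < n then \<mu> * cnj (a i) else \<mu> * of_real \<tau> * cnj (a n))"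
  have \<tau>0: "1 + norm (a 0) > 0" by (simp add: add_pos_nonneg)
  have \<tau>: "\<tau> > 0" "\<tau> * norm (a 0) = 1 - \<tau>"
    using \<tau>0 unfolding \<tau>_def by (simp_all add: divide_simps)
  have S0: "S \<ge> 0" unfolding S_def by (intro sum_nonneg) auto
  have S: "(\<Sum>i<n. a i * q i) = \<mu> * of_real S"
    unfolding S_def of_real_sum sum_distrib_left
    by (intro sum.cong refl) (metis q_def lessThan_iff complex_norm_square mult.left_commute)
  have qn: "a n * q n = \<mu> * of_real (\<tau> * b)"
    unfolding q_def b_def of_real_mult complex_norm_square by simp
  have norm_qn: "(norm (q n))\<^sup>2 = \<tau>\<^sup>2 * b"
    using \<mu> \<tau> by (simp add: q_def b_def norm_mult power_mult_distrib)
  have "norm (a (2 * n) + 2 * (\<Sum>i\<le>n. a i * q i) + a 0 * (q n)\<^sup>2) \<le> 1 + (\<Sum>i\<le>n. (norm (q i))\<^sup>2)"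
    using coeff_test_poly_le[OF f ps n, of "2 * n" n q] by simp
  also have "(\<Sum>i\<le>n. (norm (q i))\<^sup>2) = S + \<tau>\<^sup>2 * b"
    using \<mu> unfolding lessThan_Suc_atMost[symmetric] sum.lessThan_Suc norm_qn
    by (simp add: q_def norm_mult S_def)
  finally have le: "norm (a (2 * n) + 2 * (\<Sum>i\<le>n. a i * q i) + a 0 * (q n)\<^sup>2) \<le> 1 + S + \<tau>\<^sup>2 * b"
    by simp
  have "a (2 * n) + 2 * (\<Sum>i\<le>n. a i * q i) = \<mu> * of_real (norm (a (2 * n)) + 2 * S + 2 * \<tau> * b)"
    unfolding lessThan_Suc_atMost[symmetric] sum.lessThan_Suc S qn
    by (subst \<mu>(2)) (simp add: algebra_simps)
  then have "norm (a (2 * n) + 2 * (\<Sum>i\<le>n. a i * q i)) = norm (a (2 * n)) + 2 * S + 2 * \<tau> * b"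
    using S0 \<tau> by (simp only: norm_mult \<mu>(1) norm_of_real) (simp add: b_def)
  moreover have "norm (a 0 * (q n)\<^sup>2) = norm (a 0) * \<tau>\<^sup>2 * b"
    by (simp add: norm_mult norm_power norm_qn)
  moreover have "norm (a 0) * \<tau>\<^sup>2 * b = (\<tau> - \<tau>\<^sup>2) * b"
    using \<tau>(2) by (metis mult.commute mult.left_commute power2_eq_square right_diff_distrib mult_1_right)
  ultimately have "norm (a (2 * n)) + 2 * S + 2 * \<tau> * b - (\<tau> - \<tau>\<^sup>2) * b \<le> 1 + S + \<tau>\<^sup>2 * b"
    using le norm_diff_ineq[of "a (2 * n) + 2 * (\<Sum>i\<le>n. a i * q i)" "a 0 * (q n)\<^sup>2"] by linarith
  then have "norm (a (2 * n)) + S + \<tau> * b \<le> 1"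
    by (simp add: algebra_simps)
  then show ?thesis by (simp add: S_def b_def \<tau>_def)
qed

text \<open>Follows by discarding the nonnegative squares in Carlson's inequalities; index 0 is the
  bound on \<open>f 0\<close>. This uniform bound gives convergence of the series below.\<close>

lemma norm_coeff_le_1:
  assumes "f \<in> \<B>" and "has_power_series_on_disk f a"
  shows "norm (a n) \<le> 1"
proof (cases "n = 0")
  case True
  show ?thesis
    using power_series_coeff_0[OF assms(2)] analytic_self_mapsD(2)[OF assms(1), of 0] True by simp
next
  case False
  show ?thesis
  proof (cases "even n")
    case True
    then obtain k where k: "n = 2 * k" by blast
    have drop: "u \<le> 1" if "u + v + w \<le> 1" "0 \<le> v" "0 \<le> w" for u v w :: real
      using that by linarith
    have "norm (a (2 * k)) \<le> 1"
      by (rule drop[OF Carlson_even[OF assms]])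
         (use k \<open>n \<noteq> 0\<close> in \<open>auto intro!: sum_nonneg divide_nonneg_nonneg\<close>)
    then show ?thesis using k by simp
  next
    case False
    then obtain k where k: "n = 2 * k + 1" by (blast elim: oddE)
    have "0 \<le> (\<Sum>i\<le>k. (norm (a i))\<^sup>2)" by (auto intro!: sum_nonneg)
    then show ?thesis unfolding k using Carlson_odd[OF assms, of k] by linarith
  qed
qed

section \<open>Upper estimates for the Bohr sum and the condition at radius 1/3\<close>

lemma summable_mult_power_bounded:
  fixes c :: "nat \<Rightarrow> real"
  assumes "\<And>n. \<bar>c n\<bar> \<le> C" and "0 \<le> x" "x < 1"
  shows "summable (\<lambda>n. c n * x ^ n)"
proof (rule summable_comparison_test'[where N = 0])
  show "summable (\<lambda>n. C * x ^ n)" using assms by (intro summable_mult summable_geometric) auto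
qed (use assms in \<open>auto simp: abs_mult intro!: mult_right_mono\<close>)

text \<open>Consecutive odd and even degrees are paired and bounded by Carlson's inequalities. The
  resulting partial sums \<open>B n\<close> of squares turn, by summation by parts, into the part of
  the weight equal to \<open>r / (1 - r)\<close>; the last term of the even inequality produces the
  part \<open>1 / (1 + \<alpha>)\<close>.\<close>

lemma refined_Bohr_inequality:
  assumes f: "f \<in> \<B>" and ps: "has_power_series_on_disk f a" and r: "0 \<le> r" "r < 1"
  shows "(\<Sum>n. norm (a (Suc n)) * r ^ Suc n)
           + (1 / (1 + norm (a 0)) + r / (1 - r)) * (\<Sum>n. (norm (a (Suc n)))\<^sup>2 * r ^ (2 * Suc n))
         \<le> (1 - (norm (a 0))\<^sup>2) * (r / (1 - r))"
proof -
  define b where "b = (\<lambda>n. (norm (a (Suc n)))\<^sup>2)"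
  define B where "B = (\<lambda>n. \<Sum>k<n. b k)"
  define \<alpha> where "\<alpha> = norm (a 0)"
  define x where "x = r\<^sup>2"
  define c where "c = (\<lambda>n. norm (a (Suc n)) * r ^ Suc n)"
  define T where "T = (\<Sum>n. B n * x ^ n)"
  define U where "U = (\<Sum>n. b n * x ^ n)"
  have \<alpha>: "\<alpha> \<ge> 0" by (simp add: \<alpha>_def)
  have x: "0 \<le> x" "x < 1" using r by (auto simp: x_def power_less_one_iff)
  \<comment> \<open>Index 0 is split off as \<open>\<alpha>^2\<close>, so \<open>B n\<close>
    collects the squares of degrees 1 to \<open>n\<close>, and \<open>b n\<close> belongs to degree
    \<open>n + 1\<close>.\<close>
  have odd: "norm (a (2 * n + 1)) \<le> 1 - \<alpha>\<^sup>2 - B n" for n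
    using Carlson_odd[OF f ps, of n]
    by (simp add: sum.atMost_shift \<alpha>_def B_def b_def)
  have even: "norm (a (2 * n + 2)) \<le> 1 - \<alpha>\<^sup>2 - B n - b n / (1 + \<alpha>)" for n
    using Carlson_even[OF f ps, of "Suc n"]
    unfolding sum.lessThan_Suc_shift by (simp add: \<alpha>_def B_def b_def)
  have B0: "B n \<ge> 0" for n unfolding B_def b_def by (intro sum_nonneg) auto
  have B1: "B n \<le> 1" for n
    using odd[of n] zero_le_power2[of \<alpha>] norm_ge_zero[of "a (2 * n + 1)"] by linarith
  have b1: "\<bar>b n\<bar> \<le> 1" for n
    unfolding b_def using norm_coeff_le_1[OF f ps] by (simp add: power_le_one)
  have sB: "summable (\<lambda>n. B n * x ^ n)"
    by (rule summable_mult_power_bounded[where C = 1]) (use B0 B1 x in auto)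
  have sb: "summable (\<lambda>n. b n * x ^ n)"
    by (rule summable_mult_power_bounded[where C = 1]) (use b1 x in auto)
  \<comment> \<open>Since \<open>B 0 = 0\<close> and \<open>B (Suc n) = B n + b n\<close>, shifting
    the index relates the generating function of the partial sums to that of their terms.\<close>
  have T: "T = x * T + x * U"
  proof -
    have "T = (\<Sum>n. B (Suc n) * x ^ Suc n)"
      using suminf_split_head[OF sB] by (simp add: T_def B_def)
    also have "\<dots> = (\<Sum>n. x * (B n * x ^ n) + x * (b n * x ^ n))"
      by (simp add: B_def algebra_simps)
    also have "\<dots> = x * T + x * U"
      unfolding T_def U_def using sB sb
      by (simp add: suminf_add[symmetric] suminf_mult summable_mult)
    finally show ?thesis .
  qed
  have sc: "summable c"
    unfolding c_def
    using summable_mult_power_bounded[of "\<lambda>n. norm (a (Suc n))" 1 r, THEN summable_mult[of _ r]]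
      norm_coeff_le_1[OF f ps] r by (simp add: mult_ac)
  \<comment> \<open>Because \<open>c n\<close> carries degree \<open>n + 1\<close>, each pair
    consists of the degrees \<open>2 * n + 1\<close> and \<open>2 * n + 2\<close>.\<close>
  have c2: "(\<lambda>n. c (2 * n) + c (2 * n + 1)) sums (\<Sum>n. c n)"
    using sums_group[OF summable_sums[OF sc], of 2] by (simp add: mult.commute numeral_2_eq_2)
  have geo: "(\<lambda>n. x ^ n) sums (1 / (1 - x))"
    using x by (intro geometric_sums) auto
  have "(\<lambda>n. (1 - \<alpha>\<^sup>2) * (r + x) * x ^ n - (r + x) * (B n * x ^ n) - x / (1 + \<alpha>) * (b n * x ^ n)) sums
          ((1 - \<alpha>\<^sup>2) * (r + x) * (1 / (1 - x)) - (r + x) * T - x / (1 + \<alpha>) * U)"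
    unfolding T_def U_def using sB sb
    by (intro sums_diff sums_mult geo summable_sums)
  with c2 have le: "(\<Sum>n. c n) \<le> (1 - \<alpha>\<^sup>2) * (r + x) * (1 / (1 - x)) - (r + x) * T - x / (1 + \<alpha>) * U"
  proof (rule sums_le[rotated])
    fix n
    have pow: "r ^ (2 * n) = x ^ n" by (simp add: x_def power_mult)
    have "c (2 * n) = norm (a (2 * n + 1)) * (r * x ^ n)" by (simp add: c_def pow)
    moreover have "c (2 * n + 1) = norm (a (2 * n + 2)) * (x * x ^ n)"
      by (simp add: c_def pow) (simp add: x_def power2_eq_square)
    ultimately have "c (2 * n) + c (2 * n + 1) = norm (a (2 * n + 1)) * (r * x ^ n) + norm (a (2 * n + 2)) * (x * x ^ n)"
      by simp
    also have "\<dots> \<le> (1 - \<alpha>\<^sup>2 - B n) * (r * x ^ n) + (1 - \<alpha>\<^sup>2 - B n - b n / (1 + \<alpha>)) * (x * x ^ n)"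
      using odd even r x by (intro add_mono mult_right_mono) auto
    also have "\<dots> = (1 - \<alpha>\<^sup>2) * (r + x) * x ^ n - (r + x) * (B n * x ^ n) - x / (1 + \<alpha>) * (b n * x ^ n)"
      by (simp add: algebra_simps)
    finally show "c (2 * n) + c (2 * n + 1) \<le> \<dots>" .
  qed
  have rx: "(r + x) * (1 / (1 - x)) = r / (1 - r)"
  proof -
    have "1 - x = (1 - r) * (1 + r)" "r + x = r * (1 + r)"
      by (simp_all add: x_def power2_eq_square algebra_simps)
    then show ?thesis using r by simp
  qed
  \<comment> \<open>Solving the recurrence gives \<open>T = x * U / (1 - x)\<close>; with the
    previous identity this is the \<open>r / (1 - r)\<close> share of the sum of squares.\<close>
  have rT: "(r + x) * T = r / (1 - r) * (x * U)"
  proof -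
    have "T = 1 / (1 - x) * (x * U)" using T x by (simp add: field_simps)
    then have "(r + x) * T = (r + x) * (1 / (1 - x)) * (x * U)" by (simp only: mult.assoc)
    then show ?thesis unfolding rx .
  qed
  have bU: "(\<Sum>n. (norm (a (Suc n)))\<^sup>2 * r ^ (2 * Suc n)) = x * U"
    unfolding U_def suminf_mult[OF sb, symmetric]
    by (simp add: b_def x_def power_mult mult_ac power2_eq_square power_mult_distrib)
  have "(1 / (1 + \<alpha>) + r / (1 - r)) * (x * U) = x / (1 + \<alpha>) * U + r / (1 - r) * (x * U)"
    by (simp add: distrib_right)
  moreover have "(\<Sum>n. c n) \<le> (1 - \<alpha>\<^sup>2) * (r / (1 - r)) - r / (1 - r) * (x * U) - x / (1 + \<alpha>) * U"
    using le unfolding mult.assoc[of "1 - \<alpha>\<^sup>2"] rx rT .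
  ultimately show ?thesis
    unfolding bU unfolding c_def \<alpha>_def by linarith
qed

text \<open>The Schwarz lemma applies to \<open>f\<close> followed by the disk automorphism that
  sends \<open>f 0\<close> to 0; the estimate is then solved for the distance from
  \<open>f z\<close> to \<open>f 0\<close>.\<close>

lemma Schwarz_Pick_origin:
  assumes f: "f \<in> \<B>" and z: "norm z < 1"
  shows "norm (f z - f 0) * (1 - norm (f 0) * norm z) \<le> norm z * (1 - (norm (f 0))\<^sup>2)"
proof -
  note holf = analytic_self_mapsD(1)[OF f] and f1 = analytic_self_mapsD(2)[OF f]
  define w where "w = f 0"
  have w: "norm w < 1" using f1[of 0] by (simp add: w_def)
  define g where "g = Moebius_function 0 w \<circ> f"
  have "g holomorphic_on ball 0 1"
    unfolding g_def
    by (rule holomorphic_on_compose_gen[OF holf Moebius_function_holomorphic[OF w]]) (use f1 in auto)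
  moreover have "g 0 = 0" by (simp add: g_def w_def Moebius_function_eq_zero)
  moreover have "norm (g z) < 1" if "norm z < 1" for z
    using that w f1 by (simp add: g_def Moebius_function_norm_lt_1)
  ultimately have gz: "norm (g z) \<le> norm z"
    using z by (intro Schwarz_Lemma) auto
  have "norm (cnj w * f z) < 1"
    using w f1[OF z] by (metis complex_mod_cnj mult.right_neutral norm_mult_less norm_one)
  then have "1 - cnj w * f z \<noteq> 0" by auto
  then have "norm (f z - w) \<le> norm z * norm (1 - cnj w * f z)"
    using gz by (simp add: g_def Moebius_function_simple norm_divide divide_simps)
  \<comment> \<open>Expressing the denominator through \<open>f z - w\<close> makes the inequality
    linear in \<open>norm (f z - w)\<close> after the triangle inequality.\<close>
  also have "1 - cnj w * f z = of_real (1 - (norm w)\<^sup>2) - cnj w * (f z - w)"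
    unfolding of_real_diff complex_norm_square by (simp add: algebra_simps)
  also have "norm \<dots> \<le> (1 - (norm w)\<^sup>2) + norm w * norm (f z - w)"
    using norm_triangle_ineq4[of "of_real (1 - (norm w)\<^sup>2)" "cnj w * (f z - w)"] w
    unfolding norm_of_real by (simp add: norm_mult power_le_one)
  finally have "norm (f z - w) \<le> norm z * ((1 - (norm w)\<^sup>2) + norm w * norm (f z - w))"
    by (simp add: mult_left_mono)
  then show ?thesis
    by (simp add: w_def algebra_simps)
qed

text \<open>Both \<open>1 - (a + (1 - a^2) / 2)\<close> and the squared term contain the positive
  factor \<open>(1 - a)^2\<close>. After cancelling it, square roots of nonnegative quantities
  reduce the condition to one linear in \<open>a\<close>.\<close>

lemma Bohr_radius_condition:
  fixes a :: real
  assumes "0 \<le> a" "a < 1"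
  shows "a + (1 - a\<^sup>2) / 2 + ((1 - a\<^sup>2) / (3 - a))\<^sup>2 \<le> 1 \<longleftrightarrow> a \<le> 4 * sqrt 2 - 5"
proof -
  have "a + (1 - a\<^sup>2) / 2 + ((1 - a\<^sup>2) / (3 - a))\<^sup>2 \<le> 1 \<longleftrightarrow>
        (1 - a)\<^sup>2 * (1 + a)\<^sup>2 / (3 - a)\<^sup>2 \<le> (1 - a)\<^sup>2 * (1 / 2)"
  proof -
    have "1 - (a + (1 - a\<^sup>2) / 2) = (1 - a)\<^sup>2 * (1 / 2)"
      by (simp add: power2_eq_square field_simps)
    moreover have "((1 - a\<^sup>2) / (3 - a))\<^sup>2 = (1 - a)\<^sup>2 * (1 + a)\<^sup>2 / (3 - a)\<^sup>2"
      by (simp add: power_divide power2_eq_square algebra_simps)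
    ultimately show ?thesis by linarith
  qed
  also have "\<dots> \<longleftrightarrow> (1 + a)\<^sup>2 / (3 - a)\<^sup>2 \<le> 1 / 2"
    using assms mult_le_cancel_left_pos[of "(1 - a)\<^sup>2" "(1 + a)\<^sup>2 / (3 - a)\<^sup>2" "1 / 2"] by simp
  also have "\<dots> \<longleftrightarrow> (sqrt 2 * (1 + a))\<^sup>2 \<le> (3 - a)\<^sup>2"
  proof -
    have "(sqrt 2 * (1 + a))\<^sup>2 = 2 * (1 + a)\<^sup>2" by (simp add: power_mult_distrib)
    moreover have "(3 - a)\<^sup>2 > 0" using assms by simp
    ultimately show ?thesis by (simp only: pos_divide_le_eq) linarith
  qed
  also have "\<dots> \<longleftrightarrow> sqrt 2 * (1 + a) \<le> 3 - a"
  proof -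
    have "0 \<le> sqrt 2 * (1 + a)" "0 \<le> 3 - a" using assms by auto
    then show ?thesis by (simp only: abs_le_square_iff[symmetric] abs_of_nonneg)
  qed
  \<comment> \<open>The linear condition reads \<open>(sqrt 2 + 1) * a \<le> 3 - sqrt 2\<close>, and
    \<open>4 * sqrt 2 - 5\<close> is the rationalized quotient.\<close>
  also have "\<dots> \<longleftrightarrow> (sqrt 2 + 1) * a \<le> (sqrt 2 + 1) * (4 * sqrt 2 - 5)"
  proof -
    have "(x + 1) * (4 * x - 5) = 4 * (x * x) - x - 5" for x :: real
      by (simp add: algebra_simps)
    then have "(sqrt 2 + 1) * (4 * sqrt 2 - 5) = 3 - sqrt 2" by simp
    then show ?thesis by (simp only:) (simp add: algebra_simps)
  qed
  also have "\<dots> \<longleftrightarrow> a \<le> 4 * sqrt 2 - 5"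
    by (intro mult_le_cancel_left_pos) (simp add: add_pos_pos)
  finally show ?thesis .
qed

lemma Bohr_sum_le:
  assumes f: "f \<in> \<B>" and ps: "has_power_series_on_disk f a" and z: "norm z = r" "r \<le> 1 / 3"
    and a0: "norm (a 0) \<le> 4 * sqrt 2 - 5"
  shows "(\<Sum>n. norm (a n) * r ^ n)
           + (1 / (1 + norm (a 0)) + r / (1 - r)) * (\<Sum>n. (norm (a (Suc n)))\<^sup>2 * r ^ (2 * Suc n))
           + (norm (f z - a 0))\<^sup>2 \<le> 1"
proof -
  define \<alpha> where "\<alpha> = norm (a 0)"
  have f0: "f 0 = a 0" by (rule power_series_coeff_0[OF ps])
  have r: "0 \<le> r" "r < 1" using z by auto
  have \<alpha>: "0 \<le> \<alpha>" "\<alpha> < 1"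
    using analytic_self_mapsD(2)[OF f, of 0] by (auto simp: \<alpha>_def f0)
  have \<alpha>2: "0 \<le> 1 - \<alpha>\<^sup>2" using \<alpha> by (simp add: power_le_one)
  have "\<alpha> * r \<le> 1 * (1 / 3)" using \<alpha> z r by (intro mult_mono) auto
  then have pos: "1 - \<alpha> * r > 0" by simp
  have "norm (f z - a 0) \<le> r * (1 - \<alpha>\<^sup>2) / (1 - \<alpha> * r)"
    using Schwarz_Pick_origin[OF f, of z] z r pos by (simp add: f0 \<alpha>_def pos_le_divide_eq)
  also have "\<dots> = (1 - \<alpha>\<^sup>2) * (r / (1 - \<alpha> * r))" by simp
  \<comment> \<open>After clearing denominators the terms in \<open>\<alpha> * r\<close> cancel and
    \<open>3 * r \<le> 1\<close> remains.\<close>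
  also have "r / (1 - \<alpha> * r) \<le> 1 / (3 - \<alpha>)"
    using z \<alpha> pos by (simp add: field_simps)
  finally have "norm (f z - a 0) \<le> (1 - \<alpha>\<^sup>2) / (3 - \<alpha>)"
    using \<alpha>2 by (simp add: mult_left_mono)
  then have sq: "(norm (f z - a 0))\<^sup>2 \<le> ((1 - \<alpha>\<^sup>2) / (3 - \<alpha>))\<^sup>2"
    by (rule power_mono) simp
  have "r / (1 - r) \<le> 1 / 2" using z r by (simp add: field_simps)
  then have half: "(1 - \<alpha>\<^sup>2) * (r / (1 - r)) \<le> (1 - \<alpha>\<^sup>2) / 2"
    using mult_left_mono[OF _ \<alpha>2] by fastforce
  have "summable (\<lambda>n. norm (a n) * r ^ n)"
    by (rule summable_mult_power_bounded[where C = 1]) (use norm_coeff_le_1[OF f ps] r in auto)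
  from suminf_split_head[OF this]
  have "(\<Sum>n. norm (a n) * r ^ n) = \<alpha> + (\<Sum>n. norm (a (Suc n)) * r ^ Suc n)"
    by (simp add: \<alpha>_def)
  then show ?thesis
    using refined_Bohr_inequality[OF f ps r] sq half Bohr_radius_condition[OF \<alpha>] a0
    unfolding \<alpha>_def[symmetric] by linarith
qed

section \<open>The extremal disk automorphisms\<close>

lemma Moebius_power_series:
  assumes "norm w < 1"
  shows "has_power_series_on_disk (\<lambda>z. - Moebius_function 0 w z)
           (case_nat w (\<lambda>n. - of_real (1 - (norm w)\<^sup>2) * cnj w ^ n))"
  unfolding has_power_series_on_disk_def
proof
  fix z :: complex assume "z \<in> \<bbbD>"
  then have wz: "norm (cnj w * z) < 1"
    using assms by (metis complex_mod_cnj mem_ball_0 mult.right_neutral norm_mult_less norm_one)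
  \<comment> \<open>The map is
    \<open>(w - z) / (1 - cnj w * z) = w - C * z / (1 - cnj w * z)\<close>, so a geometric series
    gives every coefficient after the constant one.\<close>
  define C where "C = complex_of_real (1 - (norm w)\<^sup>2)"
  have C: "C = 1 - w * cnj w" by (simp only: C_def of_real_diff complex_norm_square of_real_1)
  have "(\<lambda>n. (- C * z) * (cnj w * z) ^ n) sums ((- C * z) * (1 / (1 - cnj w * z)))"
    by (intro sums_mult geometric_sums wz)
  then have "(\<lambda>n. case_nat w (\<lambda>n. - C * cnj w ^ n) (Suc n) * z ^ Suc n) sums
      ((- C * z) * (1 / (1 - cnj w * z)))"
    by (simp add: power_mult_distrib mult_ac)
  from sums_Suc[OF this]
  have "(\<lambda>n. case_nat w (\<lambda>n. - C * cnj w ^ n) n * z ^ n) sums ((- C * z) * (1 / (1 - cnj w * z)) + w)"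
    by simp
  also have "1 - cnj w * z \<noteq> 0" using wz by auto
  then have "(- C * z) * (1 / (1 - cnj w * z)) + w = - Moebius_function 0 w z"
    by (simp add: Moebius_function_simple C field_simps)
  finally show "(\<lambda>n. case_nat w (\<lambda>n. - complex_of_real (1 - (norm w)\<^sup>2) * cnj w ^ n) n * z ^ n) sums
      - Moebius_function 0 w z" by (simp only: C_def)
qed

lemma Moebius_in_self_maps:
  assumes "norm w < 1"
  shows "(\<lambda>z. - Moebius_function 0 w z) \<in> \<B>"
  using assms Moebius_function_norm_lt_1[OF assms]
  by (auto simp: analytic_self_maps_def analytic_on_open
           intro!: holomorphic_on_minus Moebius_function_holomorphic)

text \<open>From degree 1 on the coefficient moduli form a geometric sequence, so both series have
  closed forms. The point \<open>w / (3 * norm w)\<close> lies in the direction of \<open>w\<close>,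
  which makes \<open>cnj w * z\<close> real and positive and attains the Schwarz-Pick bound.\<close>

lemma Moebius_Bohr_sum:
  fixes w :: complex
  defines "a \<equiv> case_nat w (\<lambda>n. - of_real (1 - (norm w)\<^sup>2) * cnj w ^ n)"
  assumes w: "norm w < 1" "w \<noteq> 0"
  shows "(\<Sum>n. norm (a n) * (1 / 3) ^ n)
           + (1 / (1 + norm w) + (1 / 3) / (1 - 1 / 3)) * (\<Sum>n. (norm (a (Suc n)))\<^sup>2 * (1 / 3) ^ (2 * Suc n))
           + (norm (- Moebius_function 0 w (w / (3 * norm w)) - w))\<^sup>2
         = norm w + (1 - (norm w)\<^sup>2) / 2 + ((1 - (norm w)\<^sup>2) / (3 - norm w))\<^sup>2"
proof -
  define \<alpha> where "\<alpha> = norm w"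
  have \<alpha>: "0 < \<alpha>" "\<alpha> < 1" using w by (auto simp: \<alpha>_def)
  have \<alpha>2: "0 \<le> 1 - \<alpha>\<^sup>2" using \<alpha> by (simp add: power_le_one)
  have norm_a: "norm (a (Suc n)) = (1 - \<alpha>\<^sup>2) * \<alpha> ^ n" for n
    using \<alpha>2 by (simp add: a_def norm_mult norm_power \<alpha>_def del: of_real_diff)
  have "(\<lambda>n. (1 - \<alpha>\<^sup>2) / 3 * (\<alpha> / 3) ^ n) sums ((1 - \<alpha>\<^sup>2) / 3 * (1 / (1 - \<alpha> / 3)))"
    using \<alpha> by (intro sums_mult geometric_sums) auto
  also have "(\<lambda>n. (1 - \<alpha>\<^sup>2) / 3 * (\<alpha> / 3) ^ n) = (\<lambda>n. norm (a (Suc n)) * (1 / 3) ^ Suc n)"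
    by (simp add: norm_a power_divide)
  also have "(1 - \<alpha>\<^sup>2) / 3 * (1 / (1 - \<alpha> / 3)) = (1 - \<alpha>\<^sup>2) / (3 - \<alpha>)"
    using \<alpha> by (simp add: field_simps)
  finally have "(\<lambda>n. norm (a n) * (1 / 3) ^ n) sums ((1 - \<alpha>\<^sup>2) / (3 - \<alpha>) + norm (a 0) * (1 / 3) ^ 0)"
    by (rule sums_Suc)
  then have sum1: "(\<Sum>n. norm (a n) * (1 / 3) ^ n) = \<alpha> + (1 - \<alpha>\<^sup>2) / (3 - \<alpha>)"
    by (simp add: sums_iff a_def \<alpha>_def)
  have sq1: "\<alpha>\<^sup>2 < 9" using \<alpha> power_less_one_iff[of \<alpha> 2] by simp
  have "(\<lambda>n. (1 - \<alpha>\<^sup>2)\<^sup>2 / 9 * (\<alpha>\<^sup>2 / 9) ^ n) sums ((1 - \<alpha>\<^sup>2)\<^sup>2 / 9 * (1 / (1 - \<alpha>\<^sup>2 / 9)))"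
    using sq1 by (intro sums_mult geometric_sums) auto
  also have "(\<lambda>n. (1 - \<alpha>\<^sup>2)\<^sup>2 / 9 * (\<alpha>\<^sup>2 / 9) ^ n) = (\<lambda>n. (norm (a (Suc n)))\<^sup>2 * (1 / 3) ^ (2 * Suc n))"
  proof
    fix n
    have "(1 / 3 :: real) ^ (2 * Suc n) = 1 / 9 * (1 / 9) ^ n" by (simp add: power_mult power2_eq_square)
    then show "(1 - \<alpha>\<^sup>2)\<^sup>2 / 9 * (\<alpha>\<^sup>2 / 9) ^ n = (norm (a (Suc n)))\<^sup>2 * (1 / 3) ^ (2 * Suc n)"
      by (simp add: norm_a power_divide power_mult_distrib mult.commute flip: power_mult)
  qed
  also have "(1 - \<alpha>\<^sup>2)\<^sup>2 / 9 * (1 / (1 - \<alpha>\<^sup>2 / 9)) = (1 - \<alpha>\<^sup>2)\<^sup>2 / (9 - \<alpha>\<^sup>2)"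
    using sq1 by (simp add: field_simps)
  finally have sum2: "(\<Sum>n. (norm (a (Suc n)))\<^sup>2 * (1 / 3) ^ (2 * Suc n)) = (1 - \<alpha>\<^sup>2)\<^sup>2 / (9 - \<alpha>\<^sup>2)"
    by (simp add: sums_iff)
  \<comment> \<open>The weight at radius 1/3 has numerator \<open>3 + \<alpha>\<close>, which
    cancels against a factor of \<open>9 - \<alpha>^2\<close>.\<close>
  have "(1 / (1 + \<alpha>) + (1 / 3) / (1 - 1 / 3)) * ((1 - \<alpha>\<^sup>2)\<^sup>2 / (9 - \<alpha>\<^sup>2)) =
        (3 + \<alpha>) / (2 * (1 + \<alpha>)) * ((1 - \<alpha>)\<^sup>2 * (1 + \<alpha>)\<^sup>2 / ((3 - \<alpha>) * (3 + \<alpha>)))"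
  proof -
    have "1 / (1 + \<alpha>) + (1 / 3) / (1 - 1 / 3) = (3 + \<alpha>) / (2 * (1 + \<alpha>))"
      using \<alpha> by (simp add: field_simps)
    moreover have "(1 - \<alpha>\<^sup>2)\<^sup>2 = (1 - \<alpha>)\<^sup>2 * (1 + \<alpha>)\<^sup>2" "9 - \<alpha>\<^sup>2 = (3 - \<alpha>) * (3 + \<alpha>)"
      by (simp_all add: power2_eq_square algebra_simps)
    ultimately show ?thesis by (simp only:)
  qed
  also have "\<dots> = (1 - \<alpha>)\<^sup>2 * (1 + \<alpha>) / (2 * (3 - \<alpha>))"
  proof -
    have "3 + \<alpha> \<noteq> 0" "1 + \<alpha> \<noteq> 0" "3 - \<alpha> \<noteq> 0" using \<alpha> by auto
    then show ?thesis by (simp add: divide_simps power2_eq_square) (simp add: algebra_simps)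
  qed
  finally have "(1 - \<alpha>\<^sup>2) / (3 - \<alpha>) + (1 / (1 + \<alpha>) + (1 / 3) / (1 - 1 / 3)) * ((1 - \<alpha>\<^sup>2)\<^sup>2 / (9 - \<alpha>\<^sup>2)) =
      (1 - \<alpha>\<^sup>2) / (3 - \<alpha>) + (1 - \<alpha>)\<^sup>2 * (1 + \<alpha>) / (2 * (3 - \<alpha>))" by simp
  \<comment> \<open>Factoring out \<open>1 - \<alpha>^2\<close> leaves
    \<open>2 + (1 - \<alpha>) = 3 - \<alpha>\<close> over \<open>2 * (3 - \<alpha>)\<close>.\<close>
  also have "\<dots> = (1 - \<alpha>\<^sup>2) / 2"
    using \<alpha> by (simp add: divide_simps power2_eq_square) (simp add: algebra_simps)
  finally have sums: "(1 - \<alpha>\<^sup>2) / (3 - \<alpha>) + (1 / (1 + \<alpha>) + (1 / 3) / (1 - 1 / 3)) * ((1 - \<alpha>\<^sup>2)\<^sup>2 / (9 - \<alpha>\<^sup>2)) =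
      (1 - \<alpha>\<^sup>2) / 2" .
  have ww: "cnj w * w = of_real (\<alpha>\<^sup>2)"
    unfolding \<alpha>_def complex_norm_square by (rule mult.commute)
  have cwz: "cnj w * (w / (3 * \<alpha>)) = of_real (\<alpha> / 3)"
    using \<alpha> by (simp add: ww power2_eq_square)
  have real: "1 - complex_of_real (\<alpha> / 3) = of_real (1 - \<alpha> / 3)" by simp
  have nz: "1 - complex_of_real (\<alpha> / 3) \<noteq> 0"
    unfolding real of_real_eq_0_iff using \<alpha> by simp
  have "- Moebius_function 0 w (w / (3 * \<alpha>)) - w =
      - ((w / (3 * \<alpha>) - w) + w * (1 - of_real (\<alpha> / 3))) / (1 - of_real (\<alpha> / 3))"
    using nz unfolding Moebius_function_simple cwz by (simp add: divide_simps del: of_real_divide)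
  also have "(w / (3 * \<alpha>) - w) + w * (1 - of_real (\<alpha> / 3)) = w * of_real ((1 - \<alpha>\<^sup>2) / (3 * \<alpha>))"
    using \<alpha> by (simp add: field_simps power2_eq_square)
  also have "norm (- (w * of_real ((1 - \<alpha>\<^sup>2) / (3 * \<alpha>))) / (1 - of_real (\<alpha> / 3))) =
      \<alpha> * ((1 - \<alpha>\<^sup>2) / (3 * \<alpha>)) / (1 - \<alpha> / 3)"
    using \<alpha> \<alpha>2 unfolding norm_divide norm_minus_cancel norm_mult real norm_of_real \<alpha>_def[symmetric]
    by simp
  also have "\<dots> = (1 - \<alpha>\<^sup>2) / (3 - \<alpha>)"
    using \<alpha> by (simp add: divide_simps) (simp add: algebra_simps)
  finally have diff: "norm (- Moebius_function 0 w (w / (3 * \<alpha>)) - w) = (1 - \<alpha>\<^sup>2) / (3 - \<alpha>)" .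
  show ?thesis
    unfolding \<alpha>_def[symmetric] sum1 sum2 diff using sums by linarith
qed

theorem theorem5:
  fixes a0 :: complex
  assumes "norm a0 < 1"
  shows "((\<forall>f\<in>\<B>. \<forall>a. has_power_series_on_disk f a \<and> a 0 = a0 \<longrightarrow>
            (\<forall>z r. norm z = r \<and> r \<le> 1 / 3 \<longrightarrow>
               (\<Sum>n. norm (a n) * r ^ n)
               + (1 / (1 + norm (a 0)) + r / (1 - r)) * (\<Sum>n. (norm (a (Suc n)))\<^sup>2 * r ^ (2 * Suc n))
               + (norm (f z - a 0))\<^sup>2 \<le> 1))
         \<longleftrightarrow> 0 \<le> norm a0 \<and> norm a0 \<le> 4 * sqrt 2 - 5)
       \<and> \<bar>(4 * sqrt 2 - 5) - 0.656854\<bar> < (5 / 10 ^ 7 :: real)"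
    (is "(?Bohr \<longleftrightarrow> ?small) \<and> ?approx")
proof (intro conjI iffI)
  assume Bohr: ?Bohr
  show "norm a0 \<le> 4 * sqrt 2 - 5"
  \<comment> \<open>For \<open>a0 = 0\<close> the extremal point has no direction, but the claim is
    only that \<open>4 * sqrt 2 - 5\<close> is nonnegative.\<close>
  proof (cases "a0 = 0")
    case True
    have "5 / 4 \<le> sqrt (2::real)" by (rule real_le_rsqrt) (simp add: power2_eq_square)
    then show ?thesis using True by simp
  next
    case False
    \<comment> \<open>These are the coefficients of the extremal map with constant term
      \<open>a0\<close>; its Bohr sum at the chosen point equals the bound in the radius condition,
      so the assumption forces that condition.\<close>
    let ?a = "case_nat a0 (\<lambda>n. - of_real (1 - (norm a0)\<^sup>2) * cnj a0 ^ n)"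
    have z: "norm (a0 / (3 * norm a0)) = 1 / 3"
      using False by (simp add: norm_divide norm_mult)
    have "(\<Sum>n. norm (?a n) * (1 / 3) ^ n)
           + (1 / (1 + norm (?a 0)) + (1 / 3) / (1 - 1 / 3)) * (\<Sum>n. (norm (?a (Suc n)))\<^sup>2 * (1 / 3) ^ (2 * Suc n))
           + (norm (- Moebius_function 0 a0 (a0 / (3 * norm a0)) - ?a 0))\<^sup>2 \<le> 1"
      by (rule Bohr[rule_format, OF Moebius_in_self_maps[OF assms] conjI[OF Moebius_power_series[OF assms]]])
         (use z in auto)
    then show ?thesis
      using Moebius_Bohr_sum[OF assms False] Bohr_radius_condition[of "norm a0"] assms by simp
  qed
next
  assume small: ?small
  show ?Bohr
    using small by (intro ballI allI impI, elim conjE) (rule Bohr_sum_le, auto)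
next
  \<comment> \<open>Quadrupling these bounds and subtracting 5 places the constant between 0.656854
    and 0.6568544, within the required tolerance.\<close>
  have "14142135 / 10 ^ 7 \<le> sqrt (2::real)" by (rule real_le_rsqrt) (simp add: power2_eq_square)
  moreover have "sqrt (2::real) \<le> 14142136 / 10 ^ 7" by (rule real_le_lsqrt) (simp_all add: power2_eq_square)
  ultimately show ?approx by (simp add: abs_less_iff)
qed simp

end
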